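(* Let $n\in\mathbb{N}$, $s,k\in\mathbb{Z}$ and let $f=f_n$ be an even function (mod $n$). Assume that $\nu_p(n)\le \nu_p(k)$ for every prime $p\mid n$. Then $$S_f(n,k,s) = \varphi(n) \sum_{\substack{d\mid n\\ (d,s)=1}} \frac{(\mu*f_n)(d)}{\varphi(d)}.$$
   Context: $\mathbb{N}=\{1,2,\ldots\}$; $(a,b)$ is the greatest common divisor of $a,b\in\mathbb{Z}$; $\mu$ is the Möbius function; $\varphi$ is Euler's totient function; $e(x)=e^{2\pi i x}$ for $x\in\mathbb{R}$; $\nu_p(n)$ is the exponent of the prime $p$ in the prime factorization of $n\in\mathbb{Z}$, with the convention $\nu_p(0)=\infty$ (so the hypothesis on $k$ is equivalent to $n\mid k$). All divisors in sums are positive. For fixed $n\in\mathbb{N}$, a function $f_n:\mathbb{Z}\to\mathbb{C}$ is an even function (mod $n$) if $f_n((a,n))=f_n(a)$ for every $a\in\mathbb{Z}$. For $d\in\mathbb{N}$, $(\mu*f_n)(d)=\sum_{ab=d,\ a,b\in\mathbb{N}}\mu(a)f_n(b)$ (Dirichlet convolution, with $f_n$ restricted to $\mathbb{N}$). For $f=f_n$ even (mod $n$) and $k,s\in\mathbb{Z}$, $$S_f(n,k,s):=\sum_{\substack{a=1\\ (a,n)=1}}^n f_n(a-s)\, e(ak/n).$$ *)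

theory Defs
  imports
    Complex_Main
    "HOL-Library.Extended_Nat"
    "HOL-Computational_Algebra.Squarefree"
    "HOL-Number_Theory.Totient"
begin

definition moebius_mu :: "nat \<Rightarrow> int" where
  "moebius_mu n = (if squarefree n then (-1) ^ card (prime_factors n) else 0)"

definition dirichlet_conv ::
    "(nat \<Rightarrow> 'a::comm_semiring_0) \<Rightarrow> (nat \<Rightarrow> 'a) \<Rightarrow> nat \<Rightarrow> 'a" where
  "dirichlet_conv F G d = (\<Sum>(a, b) \<in> {(a, b). 0 < a \<and> 0 < b \<and> a * b = d}. F a * G b)"

definition e_exp :: "real \<Rightarrow> complex" where
  "e_exp x = exp (2 * of_real pi * \<i> * of_real x)"

text \<open>The library's multiplicity is \<open>0\<close> at \<open>0\<close>; the value at \<open>0\<close> is taken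
  to be \<open>\<infinity>\<close> here.\<close>
definition val :: "nat \<Rightarrow> int \<Rightarrow> enat" where
  "val p m = (if m = 0 then \<infinity> else enat (multiplicity (int p) m))"

definition even_fun_mod :: "nat \<Rightarrow> (int \<Rightarrow> complex) \<Rightarrow> bool" where
  "even_fun_mod n f \<longleftrightarrow> (\<forall>a. f (gcd a (int n)) = f a)"

definition S_sum :: "(int \<Rightarrow> complex) \<Rightarrow> nat \<Rightarrow> int \<Rightarrow> int \<Rightarrow> complex" where
  "S_sum f n k s =
     (\<Sum>a \<in> {a \<in> {1..int n}. gcd a (int n) = 1}. f (a - s) * e_exp (of_int (a * k) / of_nat n))"

end

theory Submission
  imports Defs
begin

text \<open>The hypothesis on the exponents of the primes says that \<open>n\<close> divides \<open>k\<close>, so every exponential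
  factor equals \<open>1\<close> and the sum to compute is that of \<open>f (a - s)\<close> over the reduced residues \<open>a\<close>
  modulo \<open>n\<close>.

  By Moebius inversion an even function modulo \<open>n\<close> satisfies
  \<open>f m = (\<Sum>d | d dvd n \<and> d dvd m. c d)\<close>, where \<open>c\<close> is the Dirichlet convolution of the Moebius
  function with \<open>f\<close> (\<open>even_fun_mod_eq_divisor_sum\<close>). Putting \<open>m = a - s\<close> and exchanging the two
  summations leaves, for each divisor \<open>d\<close> of \<open>n\<close>, the number of units modulo \<open>n\<close> that reduce to \<open>s\<close>
  modulo \<open>d\<close>.

  If \<open>gcd d s\<close> is not \<open>1\<close> there is none, since a unit modulo \<open>n\<close> stays a unit modulo \<open>d\<close>. Otherwise
  the number is \<open>totient n / totient d\<close>, because reduction from modulus \<open>n\<close> to modulus \<open>d\<close> is a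
  surjective homomorphism of unit groups and its fibres all have the same size
  (\<open>totient_mult_card_fibre\<close>).\<close>

section \<open>Moebius inversion for even functions\<close>

text \<open>Only squarefree divisors contribute, and they are the products of the subsets of the prime
  factors of \<open>m\<close>, so the sum expands the product of \<open>1 - 1\<close> over those primes. That product is
  empty exactly when \<open>m = 1\<close>.\<close>
lemma sum_moebius_mu_dvd:
  assumes "m > 0"
  shows "(\<Sum>d | d dvd m. moebius_mu d) = (if m = 1 then 1 else 0)"
proof -
  let ?P = "prime_factors m"
  have prime_factors_Prod: "prime_factors (\<Prod>A) = A" if "A \<subseteq> ?P" for A
  proof -
    have "finite A" using that finite_subset by blast
    moreover have prime: "prime p" if "p \<in> A" for p using that \<open>A \<subseteq> ?P\<close> by auto
    moreover have "0 \<notin> A" using prime[of 0] by auto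
    ultimately show ?thesis
      by (subst prime_factors_prod) (auto simp: prime_factorization_prime)
  qed
  have Prod_prime_factors: "\<Prod>(prime_factors d) = d" if "squarefree d" for d :: nat
  proof -
    have "d \<noteq> 0" using that by (metis not_squarefree_0)
    hence "d = (\<Prod>p\<in>prime_factors d. p ^ multiplicity p d)"
      by (simp add: prod_prime_factors)
    also have "\<dots> = \<Prod>(prime_factors d)"
      using that \<open>d \<noteq> 0\<close> by (intro prod.cong) (auto simp: squarefree_factorial_semiring')
    finally show ?thesis by simp
  qed
  have squarefree_Prod: "squarefree (\<Prod>A)" if "A \<subseteq> ?P" for A
    using that by (intro squarefree_prod_coprime) (auto intro: primes_coprime squarefree_prime)
  have Prod_dvd: "\<Prod>A dvd m" if "A \<subseteq> ?P" for A
  proof -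
    have "\<Prod>A dvd \<Prod>?P" using that by (intro prod_dvd_prod_subset) auto
    also have "\<dots> dvd (\<Prod>p\<in>?P. p ^ multiplicity p m)"
      by (intro prod_dvd_prod) (auto simp: prime_factors_multiplicity)
    also have "\<dots> = m" using assms by (simp add: prod_prime_factors)
    finally show ?thesis .
  qed
  have "(\<Sum>d | d dvd m. moebius_mu d) = (\<Sum>d | d dvd m \<and> squarefree d. moebius_mu d)"
    using assms by (intro sum.mono_neutral_right) (auto simp: moebius_mu_def)
  also have "\<dots> = (\<Sum>A\<in>Pow ?P. (-1) ^ card A)"
  proof (rule sum.reindex_bij_witness[of _ "\<lambda>A. \<Prod>A" prime_factors])
    fix d assume "d \<in> {d. d dvd m \<and> squarefree d}"
    then show "\<Prod>(prime_factors d) = d" and "prime_factors d \<in> Pow ?P"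
      and "(-1) ^ card (prime_factors d) = moebius_mu d"
      using assms by (simp_all add: Prod_prime_factors moebius_mu_def dvd_prime_factors)
  next
    fix A assume "A \<in> Pow ?P"
    then show "prime_factors (\<Prod>A) = A" and "\<Prod>A \<in> {d. d dvd m \<and> squarefree d}"
      by (simp_all only: Pow_iff mem_Collect_eq prime_factors_Prod Prod_dvd squarefree_Prod simp_thms)
  qed
  also have "\<dots> = (\<Prod>p\<in>?P. 1 - 1 :: int)"
    by (subst prod_diff_conv_sum) auto
  also have "\<dots> = (if m = 1 then 1 else 0)"
    using assms by (auto simp: card_gt_0_iff prime_factorization_empty_iff)
  finally show ?thesis .
qed

text \<open>Regrouping the pairs \<open>b dvd d dvd m\<close> by \<open>b\<close>, with \<open>d = a * b\<close>, gives \<open>f b\<close> the coefficient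
  \<open>\<Sum>a | a dvd m div b. moebius_mu a\<close>, which vanishes unless \<open>b = m\<close>.\<close>
lemma moebius_inversion:
  fixes f :: "nat \<Rightarrow> 'a::comm_ring_1"
  assumes "m > 0"
  shows "(\<Sum>d | d dvd m. dirichlet_conv (\<lambda>a. of_int (moebius_mu a)) f d) = f m"
proof -
  have conv: "dirichlet_conv (\<lambda>a. of_int (moebius_mu a)) f d
     = (\<Sum>b | b dvd d. of_int (moebius_mu (d div b)) * f b)" if "d > 0" for d
    unfolding dirichlet_conv_def using that
    by (intro sum.reindex_bij_witness[of _ "\<lambda>b. (d div b, b)" snd])
      (auto elim!: dvdE)
  have "(\<Sum>d | d dvd m. dirichlet_conv (\<lambda>a. of_int (moebius_mu a)) f d)
      = (\<Sum>d | d dvd m. \<Sum>b | b dvd d. of_int (moebius_mu (d div b)) * f b)"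
    using assms by (intro sum.cong conv) (auto intro: dvd_pos_nat)
  also have "\<dots> = (\<Sum>(d,b) \<in> (SIGMA d:{d. d dvd m}. {b. b dvd d}).
      of_int (moebius_mu (d div b)) * f b)"
    using assms by (intro sum.Sigma) (auto dest: dvd_pos_nat)
  also have "\<dots> = (\<Sum>(b,a) \<in> (SIGMA b:{b. b dvd m}. {a. a dvd m div b}).
      of_int (moebius_mu a) * f b)"
    using assms
    by (intro sum.reindex_bij_witness[of _ "\<lambda>(b,a). (a * b, b)" "\<lambda>(d,b). (b, d div b)"])
      (auto elim!: dvdE)
  also have "\<dots> = (\<Sum>b | b dvd m. \<Sum>a | a dvd m div b. of_int (moebius_mu a) * f b)"
    using assms by (intro sum.Sigma[symmetric]) (auto elim!: dvdE)
  also have "\<dots> = (\<Sum>b | b dvd m. f b * of_int (\<Sum>a | a dvd m div b. moebius_mu a))"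
    by (simp add: sum_distrib_left mult.commute)
  also have "\<dots> = (\<Sum>b | b dvd m. if b = m then f b else 0)"
    using assms by (intro sum.cong refl, subst sum_moebius_mu_dvd) (auto elim!: dvdE)
  also have "\<dots> = f m"
    using assms by (simp add: sum.delta)
  finally show ?thesis .
qed

text \<open>Evenness replaces \<open>m\<close> by \<open>gcd m n\<close>, whose divisors are the divisors of \<open>n\<close> that
  divide \<open>m\<close>; Moebius inversion then makes the value at \<open>m\<close> a linear combination, with coefficients
  independent of \<open>m\<close>, of the indicator functions of \<open>d dvd m\<close>.\<close>
lemma even_fun_mod_eq_divisor_sum:
  fixes m :: int
  assumes "even_fun_mod n f" and "n > 0"
  shows "f m = (\<Sum>d | d dvd n. if int d dvd m
           then dirichlet_conv (\<lambda>a. of_int (moebius_mu a)) (\<lambda>b. f (int b)) d else 0)"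
proof -
  let ?c = "dirichlet_conv (\<lambda>a. of_int (moebius_mu a)) (\<lambda>b. f (int b))"
  let ?g = "nat (gcd m (int n))"
  have "f m = f (int ?g)" using assms(1) by (simp add: even_fun_mod_def)
  also have "\<dots> = (\<Sum>d | d dvd ?g. ?c d)" using assms(2) by (subst moebius_inversion) auto
  also have "{d. d dvd ?g} = {d. d dvd n \<and> int d dvd m}"
    by (auto simp flip: int_dvd_int_iff)
  also have "(\<Sum>d | d dvd n \<and> int d dvd m. ?c d) = (\<Sum>d | d dvd n. if int d dvd m then ?c d else 0)"
    using assms(2) by (subst sum.inter_filter[symmetric]) auto
  finally show ?thesis .
qed

section \<open>Counting units modulo n in a residue class modulo d\<close>

abbreviation reduced_residues :: "nat \<Rightarrow> int set" where
  "reduced_residues n \<equiv> {a \<in> {1..int n}. gcd a (int n) = 1}"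

lemma finite_reduced_residues: "finite (reduced_residues n)"
  by (rule finite_subset[of _ "{1..int n}"]) auto

lemma card_reduced_residues: "card (reduced_residues n) = totient n"
proof -
  have "reduced_residues n = int ` totatives n"
  proof (intro equalityI subsetI)
    fix a assume a: "a \<in> reduced_residues n"
    then obtain b where b: "a = int b" using zero_le_imp_eq_int[of a] by auto
    hence "b \<in> totatives n" using a by (simp add: in_totatives_iff coprime_iff_gcd_eq_1)
    thus "a \<in> int ` totatives n" using b by blast
  qed (auto simp: in_totatives_iff coprime_iff_gcd_eq_1)
  thus ?thesis by (simp add: card_image totient_def)
qed

text \<open>Reduction of residues from modulus \<open>n\<close> to modulus \<open>d\<close> reaches every unit: take
  \<open>u = t + d * M\<close>, where \<open>M\<close> is the product of the primes of \<open>n\<close> that do not divide \<open>t\<close>. A prime of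
  \<open>n\<close> that divides \<open>t\<close> divides neither \<open>M\<close> nor, by coprimality, \<open>d\<close>; one that does not divide \<open>t\<close>
  divides \<open>M\<close>. So every prime of \<open>n\<close> divides exactly one of the two summands.\<close>
lemma exists_coprime_representative:
  fixes t :: int and d n :: nat
  assumes "n > 0" and "coprime t (int d)"
  obtains u where "int d dvd u - t" and "coprime u (int n)"
proof -
  define M where "M = (\<Prod>p | p \<in> prime_factors n \<and> \<not> int p dvd t. int p)"
  define u where "u = t + int d * M"
  have no_common_prime: "\<not> int p dvd u" if p: "prime p" "p dvd n" for p
  proof (cases "int p dvd t")
    case True
    have "\<not> int p dvd int d"
      using True assms(2) p(1)
      by (metis coprime_common_divisor not_prime_unit prime_nat_int_transfer)
    moreover have "\<not> int p dvd M"
    proof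
      assume "int p dvd M"
      then obtain q where q: "q \<in> prime_factors n" "\<not> int q dvd t" "int p dvd int q"
        unfolding M_def using p(1) by (subst (asm) prime_dvd_prod_iff) auto
      hence "p = q" using p(1) by (auto intro: primes_dvd_imp_eq)
      thus False using q True by simp
    qed
    ultimately have "\<not> int p dvd int d * M" using p(1) by (simp add: prime_dvd_mult_iff)
    thus ?thesis using True by (simp add: u_def dvd_add_right_iff)
  next
    case False
    hence "int p dvd M" unfolding M_def using p assms(1)
      by (intro dvd_prodI) (auto simp: prime_factors_dvd)
    thus ?thesis using False by (simp add: u_def dvd_add_left_iff)
  qed
  have "coprime u (int n)"
  proof (rule ccontr)
    assume "\<not> coprime u (int n)"
    then obtain q where q: "prime q" "q dvd gcd u (int n)"
      by (metis abs_gcd_int coprime_iff_gcd_eq_1 prime_factor_int)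
    then obtain p where "q = int p" by (metis prime_ge_0_int zero_le_imp_eq_int)
    thus False using no_common_prime[of p] q by simp
  qed
  moreover have "int d dvd u - t" by (simp add: u_def)
  ultimately show ?thesis by (rule that[rotated])
qed

text \<open>Multiplication by a unit \<open>u\<close> modulo \<open>n\<close> with \<open>u * r\<close> congruent to \<open>s\<close> modulo \<open>d\<close> carries one fibre
  injectively into the other. Since \<open>r\<close> and \<open>s\<close> play symmetric roles, an inequality is enough to
  conclude that all fibres over units have the same size.\<close>
lemma card_fibre_le:
  fixes r s :: int and d n :: nat
  assumes n: "n > 0" and d: "d dvd n" and r: "coprime r (int d)" and s: "coprime s (int d)"
  shows "card {a \<in> reduced_residues n. int d dvd a - r}
    \<le> card {a \<in> reduced_residues n. int d dvd a - s}"
proof -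
  obtain r' where r': "[r * r' = 1] (mod int d)"
    using r cong_solve_coprime_int by blast
  have "coprime (r' * s) (int d)"
    using r' s by (metis cong_imp_coprime cong_sym coprime_1_left coprime_mult_left_iff)
  then obtain u where u: "int d dvd u - r' * s" "coprime u (int n)"
    using exists_coprime_representative[OF n] by blast
  have ur: "[u * r = s] (mod int d)"
  proof -
    have "[u * r = (r' * s) * r] (mod int d)"
      using u(1) by (intro cong_mult cong_refl) (simp add: cong_iff_dvd_diff)
    also have "(r' * s) * r = (r * r') * s" by simp
    also have "[\<dots> = 1 * s] (mod int d)" by (intro cong_mult r' cong_refl)
    finally show ?thesis by simp
  qed
  \<comment> \<open>The shift by 1 puts representatives into the range from 1 to \<open>n\<close>, so that \<open>n = 1\<close> is covered
    too.\<close>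
  let ?g = "\<lambda>a. (u * a - 1) mod int n + 1"
  have g: "[?g a = u * a] (mod int n)" for a
    by (simp add: cong_def mod_add_left_eq)
  show ?thesis
  proof (rule card_inj_on_le[of ?g])
    show "inj_on ?g {a \<in> reduced_residues n. int d dvd a - r}"
    proof (rule inj_onI)
      fix a b
      assume a: "a \<in> {a \<in> reduced_residues n. int d dvd a - r}"
        and b: "b \<in> {a \<in> reduced_residues n. int d dvd a - r}"
        and eq: "?g a = ?g b"
      have "[u * a = u * b] (mod int n)"
        using g[of a] g[of b] eq by (metis cong_sym cong_trans)
      hence "[a = b] (mod int n)" using u(2) by (simp add: cong_mult_lcancel)
      hence "int n dvd a - b" by (simp add: cong_iff_dvd_diff)
      moreover have "\<bar>a - b\<bar> < int n" using a b by auto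
      ultimately show "a = b" using dvd_imp_le_int[of "a - b" "int n"] by force
    qed
    show "?g ` {a \<in> reduced_residues n. int d dvd a - r}
      \<subseteq> {a \<in> reduced_residues n. int d dvd a - s}"
    proof (intro image_subsetI CollectI conjI)
      fix a assume a: "a \<in> {a \<in> reduced_residues n. int d dvd a - r}"
      show "?g a \<in> {1..int n}"
        using n pos_mod_bound[of "int n" "u * a - 1"]
        by (simp add: zless_imp_add1_zle del: pos_mod_bound)
      have "coprime a (int n)" using a by (simp add: coprime_iff_gcd_eq_1)
      hence "coprime (u * a) (int n)" using u(2) by simp
      thus "gcd (?g a) (int n) = 1"
        using g[of a] by (metis cong_imp_coprime cong_sym coprime_iff_gcd_eq_1)
      have "[?g a = u * a] (mod int d)"
        using g d by (metis cong_dvd_modulus int_dvd_int_iff)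
      also have "[u * a = u * r] (mod int d)"
        using a by (intro cong_mult cong_refl) (auto simp: cong_iff_dvd_diff)
      also note ur
      finally show "int d dvd ?g a - s" by (simp add: cong_iff_dvd_diff)
    qed
    show "finite {a \<in> reduced_residues n. int d dvd a - s}"
      by (rule finite_subset[OF _ finite_reduced_residues]) auto
  qed
qed

text \<open>The fibres over the \<open>totient d\<close> units modulo \<open>d\<close> partition the units modulo \<open>n\<close> and are equally
  large.\<close>
lemma totient_mult_card_fibre:
  fixes s :: int and d n :: nat
  assumes n: "n > 0" and d: "d dvd n" and s: "coprime s (int d)"
  shows "totient d * card {a \<in> reduced_residues n. int d dvd a - s} = totient n"
proof -
  have "d > 0" using n d by (rule dvd_pos_nat)
  let ?F = "\<lambda>r. {a \<in> reduced_residues n. int d dvd a - r}"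
  have partition: "reduced_residues n = (\<Union>r\<in>reduced_residues d. ?F r)"
  proof (intro equalityI subsetI)
    fix a assume a: "a \<in> reduced_residues n"
    let ?r = "(a - 1) mod int d + 1"
    have r: "[?r = a] (mod int d)" by (simp add: cong_def mod_add_left_eq)
    have "coprime a (int d)"
      using a d coprime_divisors[of a a "int d" "int n"] by (simp add: coprime_iff_gcd_eq_1)
    hence "gcd ?r (int d) = 1" using r by (metis cong_imp_coprime cong_sym coprime_iff_gcd_eq_1)
    moreover have "?r \<in> {1..int d}"
      using \<open>d > 0\<close> pos_mod_bound[of "int d" "a - 1"]
      by (simp add: zless_imp_add1_zle del: pos_mod_bound)
    ultimately have "?r \<in> reduced_residues d" by simp
    moreover have "int d dvd a - ?r" using r by (metis cong_iff_dvd_diff cong_sym)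
    hence "a \<in> ?F ?r" using a by simp
    ultimately show "a \<in> (\<Union>r\<in>reduced_residues d. ?F r)" by (rule UN_I)
  qed blast
  have "totient n = card (reduced_residues n)" by (rule card_reduced_residues[symmetric])
  also have "\<dots> = card (\<Union>r\<in>reduced_residues d. ?F r)" by (rule arg_cong[OF partition])
  also have "\<dots> = (\<Sum>r\<in>reduced_residues d. card (?F r))"
  proof (rule card_UN_disjoint)
    show "\<forall>i\<in>reduced_residues d. \<forall>j\<in>reduced_residues d. i \<noteq> j \<longrightarrow> ?F i \<inter> ?F j = {}"
    proof (intro ballI impI equals0I)
      fix i j a
      assume i: "i \<in> reduced_residues d" and j: "j \<in> reduced_residues d" and "i \<noteq> j"
        and a: "a \<in> ?F i \<inter> ?F j"
      have "int d dvd (a - j) - (a - i)" using a by (simp only: Int_iff mem_Collect_eq dvd_diff)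
      hence "int d dvd i - j" by simp
      moreover have "\<bar>i - j\<bar> < int d" using i j by auto
      ultimately show False using \<open>i \<noteq> j\<close> dvd_imp_le_int[of "i - j" "int d"] by force
    qed
    show "\<forall>r\<in>reduced_residues d. finite (?F r)"
      by (auto intro: finite_subset[OF _ finite_reduced_residues[of n]])
  qed (rule finite_reduced_residues)
  also have "\<dots> = (\<Sum>r\<in>reduced_residues d. card (?F s))"
  proof (rule sum.cong[OF refl])
    fix r assume "r \<in> reduced_residues d"
    hence "coprime r (int d)" by (simp add: coprime_iff_gcd_eq_1)
    thus "card (?F r) = card (?F s)" using card_fibre_le n d s by (intro antisym) auto
  qed
  also have "\<dots> = totient d * card (?F s)"
    by (simp only: sum_constant card_reduced_residues of_nat_id)
  finally show ?thesis by (rule sym)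
qed

section \<open>Evaluation of the sum\<close>

text \<open>The case \<open>k = 0\<close> is separate because there \<open>val\<close> is infinite and does not agree with
  \<open>multiplicity\<close>.\<close>
lemma dvd_if_val_le:
  assumes "n > 0" and "\<And>p::nat. prime p \<Longrightarrow> p dvd n \<Longrightarrow> val p (int n) \<le> val p k"
  shows "int n dvd k"
proof (cases "k = 0")
  case False
  show ?thesis
  proof (rule multiplicity_le_imp_dvd)
    show "int n \<noteq> 0" using assms by simp
    fix q :: int assume q: "prime q"
    then obtain p where p: "q = int p" "prime p"
      by (metis prime_int_nat_transfer int_nat_eq less_imp_le prime_gt_0_int)
    show "multiplicity q (int n) \<le> multiplicity q k"
    proof (cases "p dvd n")
      case True
      thus ?thesis using assms(2)[OF p(2) True] False assms(1) p by (simp add: val_def)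
    next
      case False
      hence "\<not> q dvd int n" using p by simp
      thus ?thesis by (simp add: not_dvd_imp_multiplicity_0)
    qed
  qed
qed simp

theorem theorem3p3:
  fixes n :: nat and s k :: int and f :: "int \<Rightarrow> complex"
  assumes "n \<ge> 1"
    and "even_fun_mod n f"
    and "\<And>p::nat. prime p \<Longrightarrow> p dvd n \<Longrightarrow> val p (int n) \<le> val p k"
  shows "S_sum f n k s =
    of_nat (totient n) *
      (\<Sum>d \<in> {d. d dvd n \<and> gcd (int d) s = 1}.
         dirichlet_conv (\<lambda>a. of_int (moebius_mu a)) (\<lambda>b. f (int b)) d / of_nat (totient d))"
proof -
  have n: "n > 0" using assms(1) by simp
  let ?c = "dirichlet_conv (\<lambda>a. of_int (moebius_mu a)) (\<lambda>b. f (int b))"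
  note f = even_fun_mod_eq_divisor_sum[OF assms(2) n]
  obtain l where k: "k = int n * l"
    using dvd_if_val_le[OF n assms(3)] by (auto elim: dvdE)
  have e: "e_exp (of_int (a * k) / of_nat n) = 1" for a
  proof -
    have "of_int (a * k) / of_nat n = (of_int (a * l) :: real)" using n by (simp add: k)
    hence "e_exp (of_int (a * k) / of_nat n) = cis (2 * pi * of_int (a * l))"
      by (simp add: e_exp_def cis_conv_exp mult_ac)
    also have "\<dots> = 1" by (rule cis_multiple_2pi) (rule Ints_of_int)
    finally show ?thesis .
  qed
  have "S_sum f n k s = (\<Sum>a\<in>reduced_residues n. \<Sum>d | d dvd n. if int d dvd a - s then ?c d else 0)"
    unfolding S_sum_def e by (subst f) simp
  also have "\<dots> = (\<Sum>d | d dvd n. \<Sum>a\<in>reduced_residues n. if int d dvd a - s then ?c d else 0)"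
    by (rule sum.swap)
  also have "\<dots> = (\<Sum>d | d dvd n. ?c d * of_nat (card {a \<in> reduced_residues n. int d dvd a - s}))"
  proof (rule sum.cong[OF refl])
    fix d
    have "(\<Sum>a\<in>reduced_residues n. if int d dvd a - s then ?c d else 0)
        = (\<Sum>a\<in>{a \<in> reduced_residues n. int d dvd a - s}. ?c d)"
      by (rule sum.inter_filter[symmetric, OF finite_reduced_residues])
    thus "(\<Sum>a\<in>reduced_residues n. if int d dvd a - s then ?c d else 0)
        = ?c d * of_nat (card {a \<in> reduced_residues n. int d dvd a - s})"
      by (simp add: mult.commute)
  qed
  also have "\<dots> = (\<Sum>d | d dvd n. if gcd (int d) s = 1
      then of_nat (totient n) * (?c d / of_nat (totient d)) else 0)"
  proof (rule sum.cong[OF refl])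
    fix d assume "d \<in> {d. d dvd n}"
    hence d: "d dvd n" "d > 0" using n by (auto intro: dvd_pos_nat)
    show "?c d * of_nat (card {a \<in> reduced_residues n. int d dvd a - s}) =
      (if gcd (int d) s = 1 then of_nat (totient n) * (?c d / of_nat (totient d)) else 0)"
    proof (cases "gcd (int d) s = 1")
      case True
      hence "totient n = totient d * card {a \<in> reduced_residues n. int d dvd a - s}"
        using totient_mult_card_fibre[OF n d(1), of s] by (simp add: coprime_iff_gcd_eq_1 gcd.commute)
      thus ?thesis using True d by simp
    next
      case False
      \<comment> \<open>If \<open>d\<close> divides \<open>a - s\<close>, then \<open>gcd d s\<close> divides \<open>a\<close> as well as \<open>n\<close>.\<close>
      have "{a \<in> reduced_residues n. int d dvd a - s} = {}"
      proof (intro equals0I)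
        fix a assume a: "a \<in> {a \<in> reduced_residues n. int d dvd a - s}"
        let ?h = "gcd (int d) s"
        have "?h dvd (a - s) + s" using a by (intro dvd_add) (auto intro: dvd_trans)
        moreover have "?h dvd int n" using d(1) by (meson dvd_trans gcd_dvd1 int_dvd_int_iff)
        ultimately have "?h dvd gcd a (int n)" by simp
        hence "?h dvd 1" using a by (simp only: mem_Collect_eq)
        thus False using False by simp
      qed
      thus ?thesis using False by (metis (no_types, lifting) card.empty mult_zero_right of_nat_0)
    qed
  qed
  also have "\<dots> = (\<Sum>d | d dvd n \<and> gcd (int d) s = 1.
      of_nat (totient n) * (?c d / of_nat (totient d)))"
    using n by (subst sum.inter_filter[symmetric]) auto
  finally show ?thesis by (simp add: sum_distrib_left)
qed

end
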